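(* Let $\lambda,\beta\in\mathbb{N}$ and $\gamma\in\mathbb{N}_0$, and let $H_n(\lambda,\beta,\gamma)$ denote the coefficient of $\frac{x^n}{n!}$ in $\frac{e^{\gamma x}}{(2-e^{\beta x})^{\lambda}}$. Then for every $\epsilon>0$ there exists $N\in\mathbb{N}$ such that for $n>N$, $$H_n(\lambda,\beta,\gamma)=\mathcal{O}\!\left(n!\left(\frac{\beta}{\log 2}+\epsilon\right)^{n}\right).$$
   Context: $\log$ denotes the natural logarithm. *)

theory Defs
  imports Complex_Main "HOL-Computational_Algebra.Formal_Power_Series" "HOL-Library.Landau_Symbols"
begin

text \<open>
  The coefficient of \<open>x\<^sup>n / n!\<close> in \<open>e\<^sup>\<gamma>\<^sup>x / (2 - e\<^sup>\<beta>\<^sup>x)\<^sup>l\<close>. The denominator has constant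
  coefficient 1, so the division is by a unit.
\<close>

definition H :: "nat \<Rightarrow> nat \<Rightarrow> nat \<Rightarrow> nat \<Rightarrow> real" where
  "H l \<beta> \<gamma> n =
     fact n * fps_nth (fps_exp (real \<gamma>) / (2 - fps_exp (real \<beta>)) ^ l) n"

end

theory Submission
  imports Defs "HOL-Analysis.FPS_Convergence"
begin

text \<open>
  The non-constant coefficients of \<open>2 - e\<^sup>\<beta>\<^sup>x\<close> have absolute values summing at \<open>\<delta> = ln 2 / \<beta>\<close> to
  \<open>e\<^sup>\<beta>\<^sup>\<delta> - 1 = 1\<close>, so the recurrence for the reciprocal series bounds its coefficients by \<open>\<delta>\<close> to the
  power \<open>-n\<close>. Its radius of convergence is thus at least \<open>\<delta>\<close>, a bound inherited by
  powers and by the product with the entire series \<open>e\<^sup>\<gamma>\<^sup>x\<close>. The estimate is the boundedness of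
  the terms of a power series inside its disc of convergence.
\<close>

text \<open>Strong induction on the recurrence for the reciprocal: its n-th coefficient is minus the
  sum, over 1 \<le> i \<le> n, of the i-th coefficient of f times the (n-i)-th of the reciprocal.
  Each term is at most \<delta>^(-n) times the i-th weight |f_i| \<delta>^i, and the weights sum to
  at most 1.\<close>

lemma fps_inverse_nth_bound:
  fixes f :: "'a :: real_normed_field fps"
  assumes "fps_nth f 0 = 1" and "\<delta> > 0"
    and "summable (\<lambda>n. norm (fps_nth f (Suc n)) * \<delta> ^ Suc n)"
    and "(\<Sum>n. norm (fps_nth f (Suc n)) * \<delta> ^ Suc n) \<le> 1"
  shows "norm (fps_nth (inverse f) n) \<le> inverse (\<delta> ^ n)"
  using natfun_inverse_bound[OF assms, of n] assms(1) by (simp add: fps_inverse_def)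

text \<open>For 0 < r < \<delta> the terms at r are dominated by a geometric series of ratio r /
  \<delta> < 1.\<close>

lemma fps_conv_radius_geI_bound:
  fixes f :: "'a :: {banach, real_normed_field} fps"
  assumes "\<delta> > 0" and bound: "\<And>n. norm (fps_nth f n) \<le> inverse (\<delta> ^ n)"
  shows "fps_conv_radius f \<ge> ereal \<delta>"
  unfolding fps_conv_radius_def
proof (rule conv_radius_geI_ex')
  fix r :: real
  assume r: "0 < r" "ereal r < ereal \<delta>"
  show "summable (\<lambda>n. fps_nth f n * of_real r ^ n)"
  proof (rule summable_comparison_test')
    show "summable (\<lambda>n. (r / \<delta>) ^ n)"
      using r by (intro summable_geometric) auto
    show "norm (fps_nth f n * of_real r ^ n) \<le> (r / \<delta>) ^ n" for n
      using mult_right_mono[OF bound[of n], of "r ^ n"] r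
      by (simp add: norm_mult norm_power power_divide field_simps)
  qed
qed

lemma fps_nth_bound_in_conv_radius:
  fixes f :: "'a :: {banach, real_normed_field} fps"
  assumes "R > 0" and "ereal (inverse R) < fps_conv_radius f"
  obtains C where "\<And>n. norm (fps_nth f n) \<le> C * R ^ n"
proof -
  have "summable (\<lambda>n. fps_nth f n * of_real (inverse R) ^ n)"
    using assms by (intro summable_fps) (simp add: norm_inverse)
  then have "Bseq (\<lambda>n. fps_nth f n * of_real (inverse R) ^ n)"
    by (intro convergent_imp_Bseq summable_imp_convergent)
  then obtain C where C: "\<And>n. norm (fps_nth f n * of_real (inverse R) ^ n) \<le> C"
    by (auto simp: Bseq_def)
  show thesis
  proof
    show "norm (fps_nth f n) \<le> C * R ^ n" for n
      using C[of n] \<open>R > 0\<close>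
      by (simp add: norm_mult norm_divide norm_power norm_inverse power_inverse field_simps)
  qed
qed

text \<open>The bound is sharp: ln 2 / b is the complex zero of 2 - e^(bx) nearest to 0, hence a
  pole of the reciprocal.\<close>

lemma fps_conv_radius_inverse_2_minus_exp:
  assumes "b > (0::real)"
  shows "fps_conv_radius (inverse (2 - fps_exp b)) \<ge> ereal (ln 2 / b)"
proof (rule fps_conv_radius_geI_bound)
  let ?f = "2 - fps_exp b" and ?\<delta> = "ln 2 / b"
  show "?\<delta> > 0"
    using assms by simp
  \<comment> \<open>The exponential series at ln 2, stripped of its constant term 1.\<close>
  have "(\<lambda>n. ln 2 ^ Suc n / fact (Suc n)) sums (exp (ln 2) - 1 :: real)"
    using exp_converges[of "ln 2 :: real"]
    by (subst sums_Suc_iff) (simp add: scaleR_conv_of_real field_simps)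
  moreover have "norm (fps_nth ?f (Suc n)) * ?\<delta> ^ Suc n = ln 2 ^ Suc n / fact (Suc n)" for n
    using assms by (simp add: numeral_fps_const power_divide power_abs del: fact_Suc power_Suc)
  ultimately have sums: "(\<lambda>n. norm (fps_nth ?f (Suc n)) * ?\<delta> ^ Suc n) sums 1"
    by simp
  show "norm (fps_nth (inverse ?f) n) \<le> inverse (?\<delta> ^ n)" for n
    using \<open>?\<delta> > 0\<close> sums
    by (intro fps_inverse_nth_bound) (auto simp: sums_iff numeral_fps_const)
qed

lemma fps_conv_radius_H:
  assumes "b > (0::real)"
  shows "fps_conv_radius (fps_exp c / (2 - fps_exp b) ^ l) \<ge> ereal (ln 2 / b)"
proof -
  let ?g = "inverse (2 - fps_exp b)"
  have "ereal (ln 2 / b) \<le> fps_conv_radius (?g ^ l)"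
    using fps_conv_radius_inverse_2_minus_exp[OF assms] fps_conv_radius_power
    by (rule order_trans)
  \<comment> \<open>The radius of a product is at least the minimum of the two radii, and that of
    \<open>fps_exp c\<close> is infinite.\<close>
  also have "\<dots> \<le> fps_conv_radius (fps_exp c * ?g ^ l)"
    using fps_conv_radius_mult[of "fps_exp c" "?g ^ l"] by simp
  also have "fps_exp c * ?g ^ l = fps_exp c / (2 - fps_exp b) ^ l"
    by (simp add: fps_divide_unit fps_inverse_power numeral_fps_const)
  finally show ?thesis .
qed

theorem theorem14:
  fixes l \<beta> \<gamma> :: nat
  assumes "l > 0" and "\<beta> > 0"
  shows "\<forall>\<epsilon>::real. \<epsilon> > 0 \<longrightarrow>
    (\<exists>N::nat. N > 0 \<and>
      (\<lambda>n. H l \<beta> \<gamma> n) \<in> O[principal {n. n > N}](\<lambda>n. fact n * (real \<beta> / ln 2 + \<epsilon>) ^ n))"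
proof (intro allI impI)
  fix \<epsilon> :: real
  assume "\<epsilon> > 0"
  \<comment> \<open>Adding \<epsilon> puts 1 / R strictly inside the disc of radius ln 2 / \<beta>,
    where the terms of the series are bounded.\<close>
  define R where "R = real \<beta> / ln 2 + \<epsilon>"
  have "real \<beta> / ln 2 > 0"
    using assms by simp
  with \<open>\<epsilon> > 0\<close> have "R > 0" and "inverse R < inverse (real \<beta> / ln 2)"
    unfolding R_def by (simp, intro less_imp_inverse_less) simp_all
  then have "ereal (inverse R) < ereal (ln 2 / real \<beta>)"
    by simp
  also have "\<dots> \<le> fps_conv_radius (fps_exp (real \<gamma>) / (2 - fps_exp (real \<beta>)) ^ l)"
    using assms by (intro fps_conv_radius_H) simp
  finally obtain C where
    "\<And>n. norm (fps_nth (fps_exp (real \<gamma>) / (2 - fps_exp (real \<beta>)) ^ l) n) \<le> C * R ^ n"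
    using fps_nth_bound_in_conv_radius[OF \<open>R > 0\<close>] by blast
  then have "norm (H l \<beta> \<gamma> n) \<le> C * norm (fact n * R ^ n)" for n
    using \<open>R > 0\<close> by (simp add: H_def abs_mult mult.left_commute)
  \<comment> \<open>The estimate holds for every n, so the threshold 1 is just a convenient positive
    choice.\<close>
  then have "H l \<beta> \<gamma> \<in> O[principal {n. n > 1}](\<lambda>n. fact n * R ^ n)"
    by (intro bigoI always_eventually) blast
  then show "\<exists>N::nat. N > 0 \<and>
      (\<lambda>n. H l \<beta> \<gamma> n) \<in> O[principal {n. n > N}](\<lambda>n. fact n * (real \<beta> / ln 2 + \<epsilon>) ^ n)"
    unfolding R_def by (intro exI[of _ 1]) simp
qed

end
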